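(* Let $\alpha\in\mathbb{C}$ with $|\alpha|\le\frac14$. Then the function $$\Theta(z)=\frac{z}{1-\alpha z},\qquad z\in\Delta,$$ belongs to the class $\mathcal{SL}^*$.
   Context: $\Delta=\{z\in\mathbb{C}:|z|<1\}$ is the open unit disk. $\mathcal{A}$ is the class of analytic functions on $\Delta$ of the form $f(z)=z+\sum_{n=2}^{\infty}a_nz^n$. For analytic functions $F,G$ on $\Delta$, $F$ is subordinate to $G$, written $F\prec G$, if there is an analytic function $\omega:\Delta\to\mathbb{C}$ with $\omega(0)=0$ and $|\omega(z)|<1$ for $z\in\Delta$ such that $F(z)=G(\omega(z))$ for all $z\in\Delta$. The class $\mathcal{SL}^*$ is $$\mathcal{SL}^*=\left\{f\in\mathcal{A}:\ \frac{zf'(z)}{f(z)}\prec\sqrt{1+z},\ z\in\Delta\right\},$$ where $\sqrt{\cdot}$ is the principal branch (value $1$ at $z=0$), and $zf'(z)/f(z)$ is understood to take the value $1$ at $z=0$. *)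

theory Defs
  imports "HOL-Complex_Analysis.Complex_Analysis"
begin

abbreviation unit_disk :: "complex set" where
  "unit_disk \<equiv> ball 0 1"

definition class_A :: "(complex \<Rightarrow> complex) set" where
  "class_A = {f. f analytic_on unit_disk \<and>
     (\<exists>a :: nat \<Rightarrow> complex. \<forall>z\<in>unit_disk.
        (\<lambda>n. a (n + 2) * z ^ (n + 2)) sums (f z - z))}"

definition subordinate :: "(complex \<Rightarrow> complex) \<Rightarrow> (complex \<Rightarrow> complex) \<Rightarrow> bool" where
  "subordinate F G \<longleftrightarrow>
     F analytic_on unit_disk \<and> G analytic_on unit_disk \<and>
     (\<exists>\<omega>. \<omega> analytic_on unit_disk \<and> \<omega> 0 = 0 \<and>
        (\<forall>z\<in>unit_disk. norm (\<omega> z) < 1) \<and>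
        (\<forall>z\<in>unit_disk. F z = G (\<omega> z)))"

text \<open>
  The value at the origin is the removable one. A zero \<open>z \<noteq> 0\<close> of \<open>f\<close> gives the junk value
  \<open>0\<close>; this admits no extra functions into \<open>class_SL\<close> below, since \<open>csqrt (1 + w) \<noteq> 0\<close> for
  \<open>norm w < 1\<close>.
\<close>
definition starlike_quotient :: "(complex \<Rightarrow> complex) \<Rightarrow> complex \<Rightarrow> complex" where
  "starlike_quotient f z = (if z = 0 then 1 else z * deriv f z / f z)"

definition class_SL :: "(complex \<Rightarrow> complex) set" where
  "class_SL = {f \<in> class_A. subordinate (starlike_quotient f) (\<lambda>z. csqrt (1 + z))}"

end

theory Submission
  imports Defs
begin

text \<open>
  The starlike quotient of \<open>z / (1 - \<alpha> * z)\<close> is \<open>1 / (1 - u)\<close> with \<open>u = \<alpha> * z\<close>, which has positive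
  real part and hence equals \<open>csqrt (1 + \<omega>)\<close> for \<open>\<omega> = 1 / (1 - u)\<^sup>2 - 1\<close>. As \<open>norm u < 1 / 4\<close>, one has
  \<open>norm (2 * u - u\<^sup>2) < 9 / 16 < norm (1 - u) ^ 2\<close>, that is, \<open>norm \<omega> < 1\<close>.
\<close>

lemma norm_inverse_square_minus_1_less_1:
  fixes u :: complex
  assumes "norm u < 1 / 4"
  shows "norm (1 / (1 - u)\<^sup>2 - 1) < 1"
proof -
  have lower: "norm (1 - u) > 3 / 4"
    using norm_triangle_ineq2[of 1 u] assms by simp
  then have "1 - u \<noteq> 0"
    by auto
  moreover have "2 * u - u\<^sup>2 = 1 - (1 - u)\<^sup>2"
    by (simp add: power2_eq_square algebra_simps)
  ultimately have eq: "1 / (1 - u)\<^sup>2 - 1 = (2 * u - u\<^sup>2) / (1 - u)\<^sup>2"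
    by (simp add: diff_divide_distrib)
  have "norm (2 * u - u\<^sup>2) \<le> 2 * norm u + (norm u)\<^sup>2"
    using norm_triangle_ineq4[of "2 * u" "u\<^sup>2"] by (simp add: norm_mult norm_power)
  \<comment> \<open>The radius \<open>1 / 4\<close> is where the two triangle-inequality bounds
    meet: \<open>2 * t + t ^ 2 = (1 - t) ^ 2\<close> holds exactly for
    \<open>t = 1 / 4\<close>.\<close>
  also have "\<dots> < 2 * (1 / 4) + (1 / 4)\<^sup>2"
    using assms by (intro add_strict_mono power_strict_mono) auto
  also have "\<dots> = (3 / 4)\<^sup>2"
    by (simp add: power2_eq_square)
  also have "\<dots> < (norm (1 - u))\<^sup>2"
    using lower by (intro power_strict_mono) auto
  finally show ?thesis
    using \<open>1 - u \<noteq> 0\<close> by (simp add: eq norm_divide norm_power)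
qed

text \<open>Inversion maps the right half-plane to itself, and there \<open>csqrt\<close> undoes
  squaring.\<close>

lemma csqrt_inverse_square:
  fixes u :: complex
  assumes "norm u < 1"
  shows "csqrt (1 / (1 - u)\<^sup>2) = 1 / (1 - u)"
proof -
  have "Re (1 - u) > 0"
    using complex_Re_le_cmod[of u] assms by simp
  then have "Re (1 / (1 - u)) > 0"
    by (simp add: Re_divide sum_power2_gt_zero_iff)
  then show ?thesis
    using csqrt_square[of "1 / (1 - u)"] by (simp add: power_one_over)
qed

theorem theorem3p2:
  fixes \<alpha> :: complex
  assumes "norm \<alpha> \<le> 1 / 4"
  shows "(\<lambda>z. z / (1 - \<alpha> * z)) \<in> class_SL"
proof -
  let ?f = "\<lambda>z. z / (1 - \<alpha> * z)"
  let ?\<omega> = "\<lambda>z. 1 / (1 - \<alpha> * z)\<^sup>2 - 1"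
  have small: "norm (\<alpha> * z) < 1 / 4" if "z \<in> unit_disk" for z
  proof -
    \<comment> \<open>As \<open>norm \<alpha> = 1 / 4\<close> is allowed, strictness has to come
      from \<open>norm z < 1\<close>.\<close>
    have "norm \<alpha> * norm z \<le> 1 / 4 * norm z"
      using assms by (intro mult_right_mono) auto
    also have "\<dots> < 1 / 4"
      using that by simp
    finally show ?thesis
      by (simp add: norm_mult)
  qed
  have nz: "1 - \<alpha> * z \<noteq> 0" if "z \<in> unit_disk" for z
    using small[OF that] by auto
  have "?f analytic_on unit_disk"
    using nz by (intro analytic_intros)
  \<comment> \<open>The coefficient of \<open>z ^ k\<close> is \<open>\<alpha> ^ (k - 1)\<close>,
    here with \<open>k = n + 2\<close>; the series is geometric once
    \<open>\<alpha> * z\<^sup>2\<close> is factored out.\<close>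
  moreover have "(\<lambda>n. \<alpha> ^ (n + 2 - 1) * z ^ (n + 2)) sums (?f z - z)" if "z \<in> unit_disk" for z
  proof -
    have "(\<lambda>n. \<alpha> * z\<^sup>2 * (\<alpha> * z) ^ n) sums (\<alpha> * z\<^sup>2 * (1 / (1 - \<alpha> * z)))"
      using small[OF that] by (intro sums_mult geometric_sums) simp
    moreover have "\<alpha> * z\<^sup>2 * (1 / (1 - \<alpha> * z)) = ?f z - z"
      using nz[OF that] by (simp add: field_simps power2_eq_square)
    ultimately show ?thesis
      by (simp add: power_mult_distrib power2_eq_square mult_ac)
  qed
  ultimately have A: "?f \<in> class_A"
    unfolding class_A_def by (auto intro!: exI[of _ "\<lambda>k. \<alpha> ^ (k - 1)"])
  have quotient: "starlike_quotient ?f z = 1 / (1 - \<alpha> * z)" if "z \<in> unit_disk" for z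
  proof (cases "z = 0")
    case False
    have "(?f has_field_derivative 1 / (1 - \<alpha> * z)\<^sup>2) (at z)"
      using nz[OF that]
      by (auto intro!: derivative_eq_intros simp: field_simps power2_eq_square)
    then have "deriv ?f z = 1 / (1 - \<alpha> * z)\<^sup>2"
      by (rule DERIV_imp_deriv)
    then show ?thesis
      using False nz[OF that] by (simp add: starlike_quotient_def power2_eq_square)
  qed (simp add: starlike_quotient_def)
  \<comment> \<open>Analyticity is carried over from the closed form, which also covers the value
    prescribed at the origin.\<close>
  have "(\<lambda>z. 1 / (1 - \<alpha> * z)) holomorphic_on unit_disk"
    using nz by (intro holomorphic_intros)
  then have "starlike_quotient ?f holomorphic_on unit_disk"
    by (rule holomorphic_transform) (simp add: quotient)
  then have "starlike_quotient ?f analytic_on unit_disk"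
    by (simp add: analytic_on_open)
  moreover have "(\<lambda>z. csqrt (1 + z)) analytic_on unit_disk"
  proof (intro analytic_intros)
    fix z :: complex
    assume "z \<in> unit_disk"
    \<comment> \<open>The branch cut is avoided because \<open>Re (1 + z) > 0\<close>.\<close>
    then show "1 + z \<notin> \<real>\<^sub>\<le>\<^sub>0"
      using abs_Re_le_cmod[of z] by (auto simp: complex_nonpos_Reals_iff)
  qed
  moreover have "?\<omega> analytic_on unit_disk"
    using nz by (intro analytic_intros) auto
  moreover have "norm (?\<omega> z) < 1" if "z \<in> unit_disk" for z
    using small[OF that] by (rule norm_inverse_square_minus_1_less_1)
  moreover have "starlike_quotient ?f z = csqrt (1 + ?\<omega> z)" if "z \<in> unit_disk" for z
    using quotient[OF that] csqrt_inverse_square[of "\<alpha> * z"] small[OF that] by simp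
  ultimately have "subordinate (starlike_quotient ?f) (\<lambda>z. csqrt (1 + z))"
    unfolding subordinate_def by (intro conjI exI[of _ ?\<omega>] ballI) simp_all
  with A show ?thesis
    by (simp add: class_SL_def)
qed

end
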